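(* Let $P:=(p_1,\ldots,p_m)\in(\mathbb{R}[x_1,\ldots,x_n])^m$ be a polynomial system with $p_i$ homogeneous of degree $d_i$ for each $i$, and set $d:=\max_i d_i$. Then: 1. $\|D^{(1)}P\|_\infty\leq d^2\|P\|_\infty$ and, for any mutually orthogonal $x,y\in S^{n-1}$, also $\|DP(x)(y)\|_2\leq d\,\|P\|_\infty$. 2. If $\deg(p_i)=d$ for all $i\in\{1,\ldots,m\}$, then also $\|D^{(1)}P\|_\infty\leq d\,\|P\|_\infty$.
   Context: $S^{n-1}$ is the Euclidean unit sphere in $\mathbb{R}^n$. $DP(x)(u)$ denotes the image of the vector $u$ under the $m\times n$ Jacobian matrix of $P$ at $x$. The norms are $\|P\|_\infty:=\sup_{x\in S^{n-1}}\sqrt{\sum_{i=1}^m p_i(x)^2}$ and $\|D^{(1)}P\|_\infty:=\sup_{x,u\in S^{n-1}}\|DP(x)(u)\|_2=\sup_{x,u\in S^{n-1}}\sqrt{\sum_{i=1}^m\langle\nabla p_i(x),u\rangle^2}$. *)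

theory Defs
  imports "HOL-Analysis.Analysis" "HOL-Library.Poly_Mapping"
begin

text \<open>A monomial in the variables indexed by \<open>'n\<close> is its exponent vector \<open>'n \<Rightarrow>\<^sub>0 nat\<close>, and a
  polynomial is the finitely supported family of its coefficients.\<close>

type_synonym 'n real_mpoly = "('n \<Rightarrow>\<^sub>0 nat) \<Rightarrow>\<^sub>0 real"

definition mon_degree :: "('n::finite \<Rightarrow>\<^sub>0 nat) \<Rightarrow> nat" where
  "mon_degree e = (\<Sum>j\<in>UNIV. Poly_Mapping.lookup e j)"

text \<open>As usual, the zero polynomial is homogeneous of every degree.\<close>

definition homogeneous :: "nat \<Rightarrow> 'n::finite real_mpoly \<Rightarrow> bool" where
  "homogeneous k p \<longleftrightarrow> (\<forall>e\<in>Poly_Mapping.keys p. mon_degree e = k)"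

definition mpoly_eval :: "'n::finite real_mpoly \<Rightarrow> real ^ 'n \<Rightarrow> real" where
  "mpoly_eval p x =
     (\<Sum>e\<in>Poly_Mapping.keys p. Poly_Mapping.lookup p e * (\<Prod>j\<in>UNIV. (x $ j) ^ Poly_Mapping.lookup e j))"

definition system_map :: "'n::finite real_mpoly ^ 'm::finite \<Rightarrow> real ^ 'n \<Rightarrow> real ^ 'm" where
  "system_map P x = (\<chi> i. mpoly_eval (P $ i) x)"

definition system_deriv :: "'n::finite real_mpoly ^ 'm::finite \<Rightarrow> real ^ 'n \<Rightarrow> real ^ 'n \<Rightarrow> real ^ 'm" where
  "system_deriv P x u = jacobian (system_map P) (at x) *v u"

text \<open>\<^const>\<open>norm\<close> on \<open>real ^ 'm\<close> is the Euclidean norm. Both suprema below are over nonempty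
  sets that are bounded above, as shown at the end, so \<open>SUP\<close> is a genuine least upper bound.\<close>

definition sup_norm :: "'n::finite real_mpoly ^ 'm::finite \<Rightarrow> real" where
  "sup_norm P = (SUP x\<in>sphere 0 1. norm (system_map P x))"

definition deriv_sup_norm :: "'n::finite real_mpoly ^ 'm::finite \<Rightarrow> real" where
  "deriv_sup_norm P = (SUP (x, u)\<in>sphere 0 1 \<times> sphere 0 1. norm (system_deriv P x u))"

lemma has_derivative_mpoly_eval:
  "(mpoly_eval p has_derivative
     (\<lambda>u. \<Sum>e\<in>Poly_Mapping.keys p. Poly_Mapping.lookup p e *
       (\<Sum>k\<in>UNIV. (of_nat (Poly_Mapping.lookup e k) * u $ k * (x $ k) ^ (Poly_Mapping.lookup e k - 1)) *
          (\<Prod>j\<in>UNIV - {k}. (x $ j) ^ Poly_Mapping.lookup e j)))) (at x)"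
  unfolding mpoly_eval_def[abs_def]
  by (intro has_derivative_sum has_derivative_mult_right has_derivative_prod has_derivative_power
        bounded_linear_imp_has_derivative bounded_linear_vec_nth)

lemma system_map_differentiable: "system_map P differentiable (at x)"
  unfolding differentiable_componentwise_within[of "system_map P"] system_map_def
  by (auto simp: Basis_vec_def inner_axis intro!: differentiableI[OF has_derivative_mpoly_eval])

lemma system_deriv_nth:
  "system_deriv P x u $ i =
     (\<Sum>e\<in>Poly_Mapping.keys (P $ i). Poly_Mapping.lookup (P $ i) e *
       (\<Sum>k\<in>UNIV. (of_nat (Poly_Mapping.lookup e k) * u $ k * (x $ k) ^ (Poly_Mapping.lookup e k - 1)) *
          (\<Prod>j\<in>UNIV - {k}. (x $ j) ^ Poly_Mapping.lookup e j)))"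
proof -
  have "(system_map P has_derivative system_deriv P x) (at x)"
    using system_map_differentiable[of P x] unfolding jacobian_works system_deriv_def .
  from bounded_linear.has_derivative[OF bounded_linear_vec_nth this, of i]
  have "(mpoly_eval (P $ i) has_derivative (\<lambda>u. system_deriv P x u $ i)) (at x)"
    by (simp add: system_map_def)
  from has_derivative_unique[OF this has_derivative_mpoly_eval] show ?thesis
    by meson
qed

lemma bdd_above_sup_norm: "bdd_above ((\<lambda>x. norm (system_map P x)) ` sphere 0 1)"
proof -
  have "continuous_on (sphere 0 1) (system_map P)"
    by (simp add: differentiable_imp_continuous_within continuous_at_imp_continuous_on system_map_differentiable)
  then show ?thesis
    by (intro bounded_imp_bdd_above compact_imp_bounded compact_continuous_image continuous_on_norm compact_sphere)
qed

lemma bdd_above_deriv_sup_norm: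
  "bdd_above ((\<lambda>(x, u). norm (system_deriv P x u)) ` (sphere 0 1 \<times> sphere 0 1))"
proof -
  have "continuous_on (sphere 0 1 \<times> sphere 0 1) (\<lambda>(x, u). system_deriv P x u)"
    unfolding case_prod_beta continuous_on_componentwise[where f = "\<lambda>z. system_deriv P (fst z) (snd z)"]
    by (auto simp: Basis_vec_def inner_axis system_deriv_nth intro!: continuous_intros)
  then have "continuous_on (sphere 0 1 \<times> sphere 0 1) (\<lambda>(x, u). norm (system_deriv P x u))"
    unfolding case_prod_beta by (rule continuous_on_norm)
  then show ?thesis
    by (intro bounded_imp_bdd_above compact_imp_bounded compact_continuous_image compact_Times compact_sphere)
qed

lemma sphere_nonempty: "sphere (0 :: real ^ 'n::finite) 1 \<noteq> {}"
  using vector_choose_size[of 1] by (auto simp: sphere_def dist_norm)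

end

theory Submission
  imports Defs "HOL-Computational_Algebra.Polynomial"
begin

text \<open>
  Along a great circle \<open>t \<mapsto> cos t x + sin t y\<close> a form of degree \<open>k\<close> becomes a trigonometric
  polynomial of degree \<open>k\<close>, so the whole system becomes a vector-valued trigonometric polynomial
  \<open>h\<close> of degree at most \<open>d\<close>, bounded by \<open>\<parallel>P\<parallel>\<close>, with \<open>h 0 = P x\<close> and \<open>h' 0 = DP(x)(y)\<close>. The analytic
  core is the Bernstein--Szego inequality
  \<open>\<parallel>d cos \<alpha> h(0) + sin \<alpha> h'(0)\<parallel> \<le> d sup \<parallel>h\<parallel>\<close>. It follows from an interpolation formula of
  M. Riesz type (\<open>riesz_interpolation\<close>): the left-hand side is a combination of values of \<open>h\<close>
  at \<open>2d\<close> equidistant nodes, with weights that alternate in sign and have total mass \<open>d\<close>. In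
  absolute value the weights are values of the Fejer kernel, so their signs are evident, and the
  formula itself is discrete Fourier orthogonality.

  The choice \<open>\<alpha> = \<pi>/2\<close> is the bound for orthogonal \<open>x\<close> and \<open>y\<close>. If all degrees equal \<open>d\<close>, Euler's
  identity \<open>DP(x)(x) = d P(x)\<close> turns \<open>DP(x)(cos \<alpha> x + sin \<alpha> y)\<close> into exactly the left-hand side
  above, which gives the bound for every unit vector. For mixed degrees, Euler's identity only gives
  \<open>\<parallel>DP(x)(x)\<parallel> \<le> d \<parallel>P\<parallel>\<close>, so a direction \<open>a x + b y\<close> with \<open>a\<^sup>2 + b\<^sup>2 = 1\<close> costs
  \<open>(\<bar>a\<bar> + \<bar>b\<bar>) d \<parallel>P\<parallel> \<le> 2 d \<parallel>P\<parallel>\<close>, which suffices once \<open>d \<ge> 2\<close>. If \<open>d \<le> 1\<close>, the constant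
  components have no derivative and may be replaced by \<open>0\<close>, which leaves a system of pure degree.
\<close>

section \<open>Discrete Fourier orthogonality and the Fejer weights\<close>

text \<open>The nodes are the \<open>N\<close>-th roots of the unimodular number \<open>cis (N \<theta>)\<close>.\<close>

definition node :: "nat \<Rightarrow> real \<Rightarrow> nat \<Rightarrow> complex" where
  "node N \<theta> j = cis (\<theta> + 2 * pi * real j / real N)"

lemma node_power:
  assumes "N > 0"
  shows "node N \<theta> j ^ N = cis (real N * \<theta>)"
proof -
  have "node N \<theta> j ^ N = cis (real N * \<theta> + 2 * pi * real j)"
    using assms by (simp add: node_def Complex.DeMoivre algebra_simps)
  also have "\<dots> = cis (real N * \<theta>) * cis (2 * pi * real j)"
    by (simp only: cis_mult)
  finally show ?thesis by simp
qed

text \<open>For \<open>a \<noteq> b\<close> the sum is geometric, and its ratio is an \<open>N\<close>-th root of unity other than \<open>1\<close>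
  because \<open>\<bar>a - b\<bar> < N\<close>.\<close>

lemma node_orthogonality:
  assumes "a < N" "b < N"
  shows "(\<Sum>j<N. node N \<theta> j ^ a * cnj (node N \<theta> j ^ b)) = (if a = b then of_nat N else 0)"
proof -
  define r where "r = cis (2 * pi * (real a - real b) / real N)"
  have eq: "node N \<theta> j ^ a * cnj (node N \<theta> j ^ b) = cis ((real a - real b) * \<theta>) * r ^ j" for j
    by (simp add: node_def r_def Complex.DeMoivre cis_cnj cis_mult)
       (simp add: algebra_simps diff_divide_distrib add_divide_distrib)
  have sum: "(\<Sum>j<N. node N \<theta> j ^ a * cnj (node N \<theta> j ^ b)) =
      cis ((real a - real b) * \<theta>) * (\<Sum>j<N. r ^ j)"
    by (simp only: eq sum_distrib_left)
  show ?thesis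
  proof (cases "a = b")
    case True
    then show ?thesis unfolding sum by (simp add: r_def)
  next
    case False
    have "r \<noteq> 1"
    proof
      assume "r = 1"
      then have "cos (2 * pi * (real a - real b) / real N) = 1"
        by (simp add: r_def complex_eq_iff)
      then obtain n :: int where "2 * pi * (real a - real b) / real N = n * 2 * pi"
        by (auto simp: cos_one_2pi_int)
      then have "2 * pi * (real a - real b) = 2 * pi * (n * real N)"
        using assms by (simp add: divide_eq_eq mult_ac)
      then have "real a - real b = n * real N" by simp
      then have "real_of_int (int a - int b) = real_of_int (n * int N)" by simp
      then have "int a - int b = n * int N" by linarith
      then have "int N dvd int a - int b" by simp
      moreover have "\<bar>int a - int b\<bar> < int N" "int a - int b \<noteq> 0"
        using assms False by auto
      ultimately show False using dvd_imp_le_int[of "int a - int b" "int N"] by simp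
    qed
    moreover have "r ^ N = 1"
    proof -
      have "r ^ N = cis (2 * pi * of_int (int a - int b))"
        using assms by (simp add: r_def Complex.DeMoivre)
      also have "\<dots> = 1" by (rule cis_multiple_2pi) simp
      finally show ?thesis .
    qed
    ultimately show ?thesis unfolding sum using False by (simp add: geometric_sum)
  qed
qed

text \<open>Parseval's identity, paired with the Dirichlet kernel, whose coefficients are all \<open>1\<close>.\<close>

lemma node_parseval:
  "(\<Sum>j<N. (\<Sum>a<N. q a * node N \<theta> j ^ a) * cnj (\<Sum>b<N. node N \<theta> j ^ b)) = of_nat N * (\<Sum>a<N. q a)"
proof -
  have "(\<Sum>j<N. (\<Sum>a<N. q a * node N \<theta> j ^ a) * cnj (\<Sum>b<N. node N \<theta> j ^ b))
      = (\<Sum>j<N. \<Sum>a<N. \<Sum>b<N. q a * (node N \<theta> j ^ a * cnj (node N \<theta> j ^ b)))"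
    by (simp add: sum_product mult.assoc)
  also have "\<dots> = (\<Sum>a<N. \<Sum>j<N. \<Sum>b<N. q a * (node N \<theta> j ^ a * cnj (node N \<theta> j ^ b)))"
    by (rule sum.swap)
  also have "\<dots> = (\<Sum>a<N. \<Sum>b<N. \<Sum>j<N. q a * (node N \<theta> j ^ a * cnj (node N \<theta> j ^ b)))"
    by (intro sum.cong refl sum.swap)
  also have "\<dots> = (\<Sum>a<N. \<Sum>b<N. q a * (if a = b then of_nat N else 0))"
    by (intro sum.cong refl, subst sum_distrib_left[symmetric])
       (simp add: node_orthogonality del: complex_cnj_power)
  also have "\<dots> = of_nat N * (\<Sum>a<N. q a)"
    by (simp add: sum_distrib_left mult.commute if_distrib[of "\<lambda>x. _ * x"] cong: if_cong)
  finally show ?thesis .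
qed

text \<open>Multiplication by \<open>w^m\<close> shifts the exponents cyclically; those that wrap around pick up
  the factor \<open>w^N\<close>.\<close>

lemma power_times_power_sum:
  fixes w :: complex
  assumes "m \<le> N"
  shows "w ^ m * (\<Sum>a<N. w ^ a) = (\<Sum>a<N. (if a < m then w ^ N else 1) * w ^ a)"
  using assms
proof (induction m)
  case 0
  then show ?case by simp
next
  case (Suc m)
  have "(\<Sum>a<N. (if a < Suc m then w ^ N else 1) * w ^ a) =
      (\<Sum>a<N. (if a < m then w ^ N else 1) * w ^ a + (if a = m then (w ^ N - 1) * w ^ a else 0))"
    by (intro sum.cong) (auto simp: less_Suc_eq algebra_simps)
  also have "\<dots> = w ^ m * (\<Sum>a<N. w ^ a) + (w ^ N - 1) * w ^ m"
    using Suc by (simp add: sum.distrib)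
  also have "w ^ N - 1 = (w - 1) * (\<Sum>a<N. w ^ a)"
    by (rule power_diff_1_eq)
  finally show ?case by (simp add: algebra_simps)
qed

definition fejer_weight :: "nat \<Rightarrow> real \<Rightarrow> nat \<Rightarrow> real" where
  "fejer_weight N \<theta> j = (cmod (\<Sum>a<N. node N \<theta> j ^ a))\<^sup>2 / (2 * real N)"

lemma fejer_weight_nonneg: "fejer_weight N \<theta> j \<ge> 0"
  by (simp add: fejer_weight_def)

text \<open>The Fejer weights turn the moment of order \<open>m\<close> into an affine function of \<open>m\<close>, which is
  how they see both a value (constant term) and a derivative (linear term).\<close>

lemma fejer_weight_moment:
  assumes "N > 0" "m \<le> N"
  shows "(\<Sum>j<N. of_real (fejer_weight N \<theta> j) * node N \<theta> j ^ m) =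
    (of_nat N + of_nat m * (cis (real N * \<theta>) - 1)) / 2"
proof -
  define z where "z = cis (real N * \<theta>)"
  have "of_nat (2 * N) * (\<Sum>j<N. of_real (fejer_weight N \<theta> j) * node N \<theta> j ^ m) =
      (\<Sum>j<N. of_nat (2 * N) * (of_real (fejer_weight N \<theta> j) * node N \<theta> j ^ m))"
    by (rule sum_distrib_left)
  also have "\<dots> =
      (\<Sum>j<N. (node N \<theta> j ^ m * (\<Sum>a<N. node N \<theta> j ^ a)) * cnj (\<Sum>b<N. node N \<theta> j ^ b))"
  proof (intro sum.cong refl)
    fix j
    define D where "D = (\<Sum>a<N. node N \<theta> j ^ a)"
    have "complex_of_real (fejer_weight N \<theta> j) = D * cnj D / of_nat (2 * N)"
      by (simp add: fejer_weight_def flip: D_def complex_norm_square)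
    then show "of_nat (2 * N) * (of_real (fejer_weight N \<theta> j) * node N \<theta> j ^ m) =
        node N \<theta> j ^ m * (\<Sum>a<N. node N \<theta> j ^ a) * cnj (\<Sum>b<N. node N \<theta> j ^ b)"
      unfolding D_def[symmetric] using assms by simp
  qed
  also have "\<dots> = (\<Sum>j<N. (\<Sum>a<N. (if a < m then z else 1) * node N \<theta> j ^ a)
      * cnj (\<Sum>b<N. node N \<theta> j ^ b))"
    by (simp only: power_times_power_sum[OF assms(2)] node_power[OF assms(1)] z_def)
  also have "\<dots> = of_nat N * (\<Sum>a<N. if a < m then z else 1)"
    by (rule node_parseval)
  also have "(\<Sum>a<N. if a < m then z else 1) = (\<Sum>a<N. 1 + (if a < m then z - 1 else 0))"
    by (intro sum.cong) auto
  also have "\<dots> = of_nat N + (\<Sum>a<N. if a < m then z - 1 else 0)"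
    by (simp add: sum.distrib)
  also have "(\<Sum>a<N. if a < m then z - 1 else 0) = (\<Sum>a\<in>{..<N} \<inter> {a. a < m}. z - 1)"
    by (subst sum.inter_restrict) auto
  also have "{..<N} \<inter> {a. a < m} = {..<m}"
    using assms by auto
  finally have "of_nat N * (2 * (\<Sum>j<N. of_real (fejer_weight N \<theta> j) * node N \<theta> j ^ m)) =
      of_nat N * (of_nat N + of_nat m * (z - 1))"
    by (simp add: algebra_simps)
  then have "2 * (\<Sum>j<N. of_real (fejer_weight N \<theta> j) * node N \<theta> j ^ m) =
      of_nat N + of_nat m * (z - 1)"
    by (rule mult_left_cancel[THEN iffD1, rotated]) (use assms in simp)
  then show ?thesis by (simp add: z_def field_simps)
qed

section \<open>Trigonometric polynomials\<close>

text \<open>Clearing the negative frequencies by the factor \<open>cis (d t)\<close> leaves an ordinary polynomial in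
  \<open>cis t\<close>; closure under products is then inherited from polynomial multiplication.\<close>

definition trig_poly :: "nat \<Rightarrow> (real \<Rightarrow> real) \<Rightarrow> bool" where
  "trig_poly d f \<longleftrightarrow> (\<exists>p :: complex poly. degree p \<le> 2 * d \<and>
     (\<forall>t. complex_of_real (f t) = cis (- (real d * t)) * poly p (cis t)))"

lemma trig_poly_const: "trig_poly 0 (\<lambda>_. c)"
  unfolding trig_poly_def by (rule exI[of _ "[:complex_of_real c:]"]) simp

lemma trig_poly_cos_sin: "trig_poly 1 (\<lambda>t. cos t * a + sin t * b)"
  unfolding trig_poly_def
proof (intro exI[of _ "[:Complex (a/2) (b/2), 0, Complex (a/2) (-b/2):]"] conjI allI)
  fix t
  have inv: "cis (- t) * cis t = 1" by (simp add: cis_mult)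
  have "cis (- (real 1 * t)) * poly [:Complex (a/2) (b/2), 0, Complex (a/2) (-b/2):] (cis t) =
      cis (- t) * Complex (a/2) (b/2) + (cis (- t) * cis t) * cis t * Complex (a/2) (-b/2)"
    by (simp add: algebra_simps)
  also have "\<dots> = complex_of_real (cos t * a + sin t * b)"
    unfolding inv by (simp add: complex_eq_iff algebra_simps)
  finally show "complex_of_real (cos t * a + sin t * b) =
      cis (- (real 1 * t)) * poly [:Complex (a/2) (b/2), 0, Complex (a/2) (-b/2):] (cis t)" ..
qed simp

lemma trig_poly_mult:
  assumes "trig_poly d f" "trig_poly e g"
  shows "trig_poly (d + e) (\<lambda>t. f t * g t)"
proof -
  obtain p q where p: "degree p \<le> 2 * d" "\<And>t. complex_of_real (f t) = cis (- (real d * t)) * poly p (cis t)"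
    and q: "degree q \<le> 2 * e" "\<And>t. complex_of_real (g t) = cis (- (real e * t)) * poly q (cis t)"
    using assms unfolding trig_poly_def by blast
  have "degree (p * q) \<le> 2 * (d + e)"
    using add_mono[OF p(1) q(1)] by (intro order_trans[OF degree_mult_le]) (simp add: algebra_simps)
  moreover have "cis (- (real d * t)) * cis (- (real e * t)) = cis (- (real (d + e) * t))" for t
    by (simp add: cis_mult algebra_simps)
  then have "complex_of_real (f t * g t) = cis (- (real (d + e) * t)) * poly (p * q) (cis t)" for t
    by (metis (no_types, lifting) p(2) q(2) of_real_mult poly_mult mult.assoc mult.left_commute)
  ultimately show ?thesis unfolding trig_poly_def by blast
qed

lemma trig_poly_add:
  assumes "trig_poly d f" "trig_poly d g"
  shows "trig_poly d (\<lambda>t. f t + g t)"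
proof -
  obtain p q where p: "degree p \<le> 2 * d" "\<And>t. complex_of_real (f t) = cis (- (real d * t)) * poly p (cis t)"
    and q: "degree q \<le> 2 * d" "\<And>t. complex_of_real (g t) = cis (- (real d * t)) * poly q (cis t)"
    using assms unfolding trig_poly_def by blast
  show ?thesis unfolding trig_poly_def
    by (rule exI[of _ "p + q"]) (use degree_add_le[OF p(1) q(1)] in \<open>simp add: p(2) q(2) algebra_simps\<close>)
qed

lemma trig_poly_one: "trig_poly d (\<lambda>_. 1)"
  unfolding trig_poly_def
proof (intro exI[of _ "monom 1 d"] conjI allI)
  show "complex_of_real 1 = cis (- (real d * t)) * poly (monom 1 d) (cis t)" for t
    by (simp add: poly_monom Complex.DeMoivre cis_mult)
qed (simp add: degree_monom_eq)

lemma trig_poly_mono: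
  assumes "trig_poly d f" "d \<le> e"
  shows "trig_poly e f"
  using trig_poly_mult[OF assms(1) trig_poly_one[of "e - d"]] assms(2) by simp

lemma trig_poly_power:
  assumes "trig_poly d f"
  shows "trig_poly (k * d) (\<lambda>t. f t ^ k)"
proof (induction k)
  case 0
  then show ?case by (simp add: trig_poly_const)
next
  case (Suc k)
  then show ?case using trig_poly_mult[OF assms Suc] by simp
qed

lemma trig_poly_prod:
  assumes "finite A" "\<And>i. i \<in> A \<Longrightarrow> trig_poly (k i) (f i)"
  shows "trig_poly (\<Sum>i\<in>A. k i) (\<lambda>t. \<Prod>i\<in>A. f i t)"
  using assms by (induction A rule: finite_induct) (auto simp: trig_poly_const intro!: trig_poly_mult)

lemma trig_poly_sum:
  assumes "finite A" "\<And>i. i \<in> A \<Longrightarrow> trig_poly d (f i)"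
  shows "trig_poly d (\<lambda>t. \<Sum>i\<in>A. f i t)"
  using assms
  by (induction A rule: finite_induct)
     (auto intro!: trig_poly_add trig_poly_mono[OF trig_poly_const])

section \<open>The Bernstein--Szego inequality\<close>

text \<open>At the node \<open>t\<^sub>j = (\<alpha> + j \<pi>) / d\<close> the factor \<open>cis (- d t\<^sub>j)\<close> equals \<open>(-1)^j cis (- \<alpha>)\<close>, so
  the sign \<open>(-1)^j\<close> turns \<open>f t\<^sub>j\<close> into \<open>cis (- \<alpha>)\<close> times an ordinary polynomial in \<open>cis t\<^sub>j\<close>.
  The moments of the Fejer weights then give the value of the sum frequency by frequency.\<close>

lemma riesz_interpolation:
  assumes d: "d > 0" and f: "trig_poly d f" and f': "(f has_real_derivative f') (at 0)"
  shows "real d * cos \<alpha> * f 0 + sin \<alpha> * f' =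
    (\<Sum>j<2 * d. fejer_weight (2 * d) (\<alpha> / real d) j * (-1) ^ j * f ((\<alpha> + pi * real j) / real d))"
proof -
  obtain p where deg: "degree p \<le> 2 * d"
    and p: "\<And>t. complex_of_real (f t) = cis (- (real d * t)) * poly p (cis t)"
    using f unfolding trig_poly_def by blast
  define c where "c = coeff p"
  have poly: "poly p w = (\<Sum>m\<le>2 * d. c m * w ^ m)" for w
  proof -
    have "poly p w = (\<Sum>m\<le>degree p. c m * w ^ m)" by (simp add: poly_altdef c_def)
    also have "\<dots> = (\<Sum>m\<le>2 * d. c m * w ^ m)"
      by (rule sum.mono_neutral_left) (use deg in \<open>auto simp: c_def coeff_eq_0\<close>)
    finally show ?thesis .
  qed
  have f_eq: "complex_of_real (f t) = (\<Sum>m\<le>2 * d. c m * cis ((real m - real d) * t))" for t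
    by (simp add: p poly sum_distrib_left Complex.DeMoivre mult.left_commute[of "cis _"] cis_mult algebra_simps)
  have cis': "((\<lambda>t. cis (r * t)) has_vector_derivative \<i> * of_real r) (at 0)" for r
  proof -
    have "((\<lambda>z. exp (\<i> * (of_real r * z))) has_field_derivative \<i> * of_real r) (at (of_real 0))"
      by (auto intro!: derivative_eq_intros)
    from has_vector_derivative_real_field[OF this] show ?thesis
      by (simp add: cis_conv_exp)
  qed
  have "((\<lambda>t. complex_of_real (f t)) has_vector_derivative
      (\<Sum>m\<le>2 * d. c m * (\<i> * of_real (real m - real d)))) (at 0)"
    unfolding f_eq
    by (intro has_vector_derivative_sum has_vector_derivative_mult_right cis')
  then have "((\<lambda>t. complex_of_real (f t)) has_vector_derivative
      (\<Sum>m\<le>2 * d. c m * (\<i> * (of_nat m - of_nat d)))) (at 0)" by simp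
  moreover have "((\<lambda>t. complex_of_real (f t)) has_vector_derivative complex_of_real f') (at 0)"
    using f' by (rule has_vector_derivative_of_real)
  ultimately have f'_eq: "complex_of_real f' = (\<Sum>m\<le>2 * d. c m * (\<i> * (of_nat m - of_nat d)))"
    by (metis vector_derivative_unique_at)
  define \<theta> where "\<theta> = \<alpha> / real d"
  define v where "v = fejer_weight (2 * d) \<theta>"
  define w where "w = node (2 * d) \<theta>"
  have node: "complex_of_real ((-1) ^ j * f ((\<alpha> + pi * real j) / real d)) =
      cis (- \<alpha>) * (\<Sum>m\<le>2 * d. c m * w j ^ m)" for j
  proof -
    define t where "t = (\<alpha> + pi * real j) / real d"
    have w: "cis t = w j"
      by (simp add: w_def node_def t_def \<theta>_def add_divide_distrib)
    have "real d * t = \<alpha> + real j * pi"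
      using d by (simp add: t_def)
    then have "cis (- (real d * t)) = cis (- \<alpha>) * cnj (cis pi ^ j)"
      by (simp add: Complex.DeMoivre cis_mult cis_cnj del: cis_pi complex_cnj_power)
    then have "cis (- (real d * t)) = cis (- \<alpha>) * (-1) ^ j" by simp
    then have "complex_of_real (f t) = cis (- \<alpha>) * (-1) ^ j * (\<Sum>m\<le>2 * d. c m * w j ^ m)"
      by (simp add: p poly w)
    then show ?thesis
      unfolding t_def[symmetric] by (simp add: algebra_simps flip: power_mult_distrib mult.assoc)
  qed
  have moment: "cis (- \<alpha>) * (\<Sum>j<2 * d. of_real (v j) * w j ^ m) =
      of_nat d * of_real (cos \<alpha>) + of_real (sin \<alpha>) * (\<i> * (of_nat m - of_nat d))"
    if "m \<le> 2 * d" for m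
  proof -
    have sum: "(\<Sum>j<2 * d. of_real (v j) * w j ^ m) =
        of_nat d + of_nat m * ((cis (2 * \<alpha>) - 1) / 2)"
      using fejer_weight_moment[of "2 * d" m \<theta>] d that
      by (simp add: v_def w_def \<theta>_def field_simps)
    have "cis (- \<alpha>) * (\<Sum>j<2 * d. of_real (v j) * w j ^ m) =
        cis (- \<alpha>) * of_nat d + of_nat m * ((cis (- \<alpha>) * cis (2 * \<alpha>) - cis (- \<alpha>)) / 2)"
      unfolding sum by (simp add: field_simps)
    also have "cis (- \<alpha>) * cis (2 * \<alpha>) = cis \<alpha>" by (simp add: cis_mult)
    also have "cis (- \<alpha>) * of_nat d + of_nat m * ((cis \<alpha> - cis (- \<alpha>)) / 2) =
        of_nat d * of_real (cos \<alpha>) + of_real (sin \<alpha>) * (\<i> * (of_nat m - of_nat d))"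
      by (simp add: complex_eq_iff algebra_simps)
    finally show ?thesis .
  qed
  have "complex_of_real (\<Sum>j<2 * d. v j * (-1) ^ j * f ((\<alpha> + pi * real j) / real d)) =
      (\<Sum>j<2 * d. of_real (v j) * (cis (- \<alpha>) * (\<Sum>m\<le>2 * d. c m * w j ^ m)))"
    by (simp only: of_real_sum of_real_mult[of "v _"] mult.assoc node)
  also have "\<dots> = (\<Sum>j<2 * d. \<Sum>m\<le>2 * d. c m * (cis (- \<alpha>) * (of_real (v j) * w j ^ m)))"
    by (simp add: sum_distrib_left algebra_simps)
  also have "\<dots> = (\<Sum>m\<le>2 * d. c m * (cis (- \<alpha>) * (\<Sum>j<2 * d. of_real (v j) * w j ^ m)))"
    by (subst sum.swap) (simp add: sum_distrib_left)
  also have "\<dots> = (\<Sum>m\<le>2 * d. c m *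
      (of_nat d * of_real (cos \<alpha>) + of_real (sin \<alpha>) * (\<i> * (of_nat m - of_nat d))))"
    by (intro sum.cong refl arg_cong2[where f = "(*)"] moment) auto
  also have "\<dots> = (\<Sum>m\<le>2 * d. c m * (of_nat d * of_real (cos \<alpha>))) +
      (\<Sum>m\<le>2 * d. c m * (of_real (sin \<alpha>) * (\<i> * (of_nat m - of_nat d))))"
    by (simp only: distrib_left sum.distrib)
  also have "(\<Sum>m\<le>2 * d. c m * (of_nat d * of_real (cos \<alpha>))) =
      of_nat d * of_real (cos \<alpha>) * of_real (f 0)"
    unfolding f_eq by (simp add: sum_distrib_left mult_ac)
  also have "(\<Sum>m\<le>2 * d. c m * (of_real (sin \<alpha>) * (\<i> * (of_nat m - of_nat d)))) =
      of_real (sin \<alpha>) * of_real f'"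
    unfolding f'_eq sum_distrib_left by (intro sum.cong refl mult.left_commute)
  also have "of_nat d * of_real (cos \<alpha>) * of_real (f 0) + of_real (sin \<alpha>) * of_real f' =
      complex_of_real (real d * cos \<alpha> * f 0 + sin \<alpha> * f')" by simp
  finally show ?thesis
    unfolding v_def \<theta>_def of_real_eq_iff by (rule sym)
qed

text \<open>The weights do not depend on the function, so the interpolation formula holds for vectors and
  the triangle inequality loses nothing but their total mass, which is the moment of order \<open>0\<close>.\<close>

lemma bernstein_szego:
  fixes h :: "real \<Rightarrow> real ^ 'm::finite"
  assumes d: "d > 0" and h: "\<And>i. trig_poly d (\<lambda>t. h t $ i)"
    and h': "(h has_vector_derivative h') (at 0)"
    and bound: "\<And>t. norm (h t) \<le> M"
  shows "norm ((real d * cos \<alpha>) *\<^sub>R h 0 + sin \<alpha> *\<^sub>R h') \<le> real d * M"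
proof -
  define v where "v = fejer_weight (2 * d) (\<alpha> / real d)"
  have "((\<lambda>t. h t $ i) has_real_derivative h' $ i) (at 0)" for i
    using bounded_linear.has_vector_derivative[OF bounded_linear_vec_nth h', of i]
    by (simp add: has_real_derivative_iff_has_vector_derivative)
  from riesz_interpolation[OF d h this]
  have "(real d * cos \<alpha>) *\<^sub>R h 0 + sin \<alpha> *\<^sub>R h' =
      (\<Sum>j<2 * d. (v j * (-1) ^ j) *\<^sub>R h ((\<alpha> + pi * real j) / real d))"
    by (simp add: vec_eq_iff v_def)
  also have "norm \<dots> \<le> (\<Sum>j<2 * d. v j * M)"
  proof (rule sum_norm_le)
    fix j
    show "norm ((v j * (-1) ^ j) *\<^sub>R h ((\<alpha> + pi * real j) / real d)) \<le> v j * M"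
      using bound fejer_weight_nonneg by (simp add: abs_mult v_def mult_left_mono)
  qed
  also have "\<dots> = real d * M"
  proof -
    have "complex_of_real (\<Sum>j<2 * d. v j) = of_real (real d)"
      using fejer_weight_moment[of "2 * d" 0 "\<alpha> / real d"] d by (simp add: v_def)
    then have "(\<Sum>j<2 * d. v j) = real d"
      by (metis of_real_eq_iff)
    then show ?thesis by (simp flip: sum_distrib_right)
  qed
  finally show ?thesis .
qed

section \<open>Homogeneous polynomials and systems\<close>

lemma mpoly_eval_scaleR:
  assumes "homogeneous k p"
  shows "mpoly_eval p (c *\<^sub>R x) = c ^ k * mpoly_eval p x"
proof -
  have "(\<Prod>j\<in>UNIV. ((c *\<^sub>R x) $ j) ^ Poly_Mapping.lookup e j) =
      c ^ k * (\<Prod>j\<in>UNIV. (x $ j) ^ Poly_Mapping.lookup e j)" if "e \<in> Poly_Mapping.keys p" for e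
  proof -
    have "(\<Sum>j\<in>UNIV. Poly_Mapping.lookup e j) = k"
      using assms that by (simp add: homogeneous_def mon_degree_def)
    then show ?thesis by (simp add: power_mult_distrib prod.distrib flip: power_sum)
  qed
  then show ?thesis
    by (simp add: mpoly_eval_def sum_distrib_left algebra_simps del: vector_scaleR_component)
qed

lemma trig_poly_mpoly_eval:
  assumes "homogeneous k p"
  shows "trig_poly k (\<lambda>t. mpoly_eval p (cos t *\<^sub>R x + sin t *\<^sub>R y))"
  unfolding mpoly_eval_def
proof (rule trig_poly_sum)
  fix e assume "e \<in> Poly_Mapping.keys p"
  then have k: "(\<Sum>j\<in>UNIV. Poly_Mapping.lookup e j * 1) = k"
    using assms by (simp add: homogeneous_def mon_degree_def)
  have "trig_poly (\<Sum>j\<in>UNIV. Poly_Mapping.lookup e j * 1)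
      (\<lambda>t. \<Prod>j\<in>UNIV. (cos t * x $ j + sin t * y $ j) ^ Poly_Mapping.lookup e j)"
    by (intro trig_poly_prod trig_poly_power trig_poly_cos_sin) simp
  from trig_poly_mult[OF trig_poly_const this]
  show "trig_poly k (\<lambda>t. Poly_Mapping.lookup p e *
      (\<Prod>j\<in>UNIV. (cos t *\<^sub>R x + sin t *\<^sub>R y) $ j ^ Poly_Mapping.lookup e j))"
    unfolding k by simp
qed simp

lemma system_map_has_derivative: "(system_map P has_derivative system_deriv P x) (at x)"
  using system_map_differentiable[of P x] unfolding jacobian_works system_deriv_def .

lemma system_map_curve_has_vector_derivative:
  assumes "(g has_vector_derivative u) (at t)"
  shows "((\<lambda>s. system_map P (g s)) has_vector_derivative system_deriv P (g t) u) (at t)"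
proof -
  interpret bounded_linear "system_deriv P (g t)"
    by (rule has_derivative_bounded_linear[OF system_map_has_derivative])
  show ?thesis
    using has_derivative_compose[OF assms[unfolded has_vector_derivative_def]
        system_map_has_derivative, of P]
    by (simp add: has_vector_derivative_def scaleR)
qed

lemma system_deriv_linear: "linear (system_deriv P x)"
  by (rule has_derivative_linear[OF system_map_has_derivative])

text \<open>Euler's identity: differentiate \<open>P (c x) = c^k P x\<close> at \<open>c = 1\<close>.\<close>

lemma system_deriv_radial:
  assumes "homogeneous k (P $ i)"
  shows "system_deriv P x x $ i = real k * system_map P x $ i"
proof -
  have "((\<lambda>c. c *\<^sub>R x) has_vector_derivative x) (at 1)"
    by (auto intro!: derivative_eq_intros)
  from bounded_linear.has_vector_derivative[OF bounded_linear_vec_nth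
      system_map_curve_has_vector_derivative[OF this], of P i]
  have "((\<lambda>c. c ^ k * mpoly_eval (P $ i) x) has_real_derivative system_deriv P x x $ i) (at 1)"
    by (simp add: system_map_def mpoly_eval_scaleR[OF assms] has_real_derivative_iff_has_vector_derivative)
  moreover have "((\<lambda>c. c ^ k * mpoly_eval (P $ i) x) has_real_derivative
      real k * mpoly_eval (P $ i) x) (at 1)"
    by (auto intro!: derivative_eq_intros)
  ultimately show ?thesis
    by (metis DERIV_unique system_map_def vec_lambda_beta)
qed

lemma norm_system_map_le_sup_norm: "norm x = 1 \<Longrightarrow> norm (system_map P x) \<le> sup_norm P"
  unfolding sup_norm_def by (intro cSUP_upper bdd_above_sup_norm) simp

lemma sup_norm_mono:
  assumes "\<And>x. norm (system_map Q x) \<le> norm (system_map P x)"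
  shows "sup_norm Q \<le> sup_norm P"
  unfolding sup_norm_def
  by (intro cSUP_mono sphere_nonempty bdd_above_sup_norm) (use assms in blast)

lemma sup_norm_nonneg: "sup_norm P \<ge> 0" for P :: "'n::finite real_mpoly ^ 'm::finite"
proof -
  obtain x :: "real ^ 'n" where "norm x = 1" using vector_choose_size[of 1] by auto
  from norm_system_map_le_sup_norm[OF this, of P] show ?thesis
    using norm_ge_zero order_trans by blast
qed

lemma deriv_sup_norm_least:
  assumes "\<And>x u. norm x = 1 \<Longrightarrow> norm u = 1 \<Longrightarrow> norm (system_deriv P x u) \<le> B"
  shows "deriv_sup_norm P \<le> B"
  unfolding deriv_sup_norm_def
  by (rule cSUP_least) (use assms sphere_nonempty in auto)

lemma system_deriv_degree_0:
  assumes "homogeneous 0 (P $ i)"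
  shows "system_deriv P x u $ i = 0"
  using assms by (simp add: system_deriv_nth homogeneous_def mon_degree_def)

section \<open>The derivative of a system on the sphere\<close>

text \<open>The system restricted to the great circle through \<open>x\<close> and \<open>y\<close> is the trigonometric polynomial
  to which the Bernstein--Szego inequality applies. The first summand is \<open>DP(x)(cos \<alpha> x)\<close>
  when all degrees equal \<open>d\<close>, and vanishes when \<open>\<alpha> = \<pi>/2\<close>.\<close>

lemma norm_great_circle_le:
  fixes P :: "'n::finite real_mpoly ^ 'm::finite"
  assumes hom: "\<And>i. homogeneous (\<delta> i) (P $ i)" and le: "\<And>i. \<delta> i \<le> d" and d: "d > 0"
    and x: "norm x = 1" and y: "norm y = 1" and orth: "orthogonal x y"
  shows "norm ((real d * cos \<alpha>) *\<^sub>R system_map P x + sin \<alpha> *\<^sub>R system_deriv P x y)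
    \<le> real d * sup_norm P"
proof -
  define g where "g t = cos t *\<^sub>R x + sin t *\<^sub>R y" for t
  define h where "h t = system_map P (g t)" for t
  have g0: "g 0 = x" by (simp add: g_def)
  have "(g has_vector_derivative y) (at 0)"
    unfolding g_def[abs_def] by (auto intro!: derivative_eq_intros)
  from system_map_curve_has_vector_derivative[OF this, of P]
  have h': "(h has_vector_derivative system_deriv P x y) (at 0)"
    by (simp add: h_def[abs_def] g0)
  have norm_g: "norm (g t) = 1" for t
  proof -
    have "(norm (g t))\<^sup>2 = (norm (cos t *\<^sub>R x))\<^sup>2 + (norm (sin t *\<^sub>R y))\<^sup>2"
      unfolding g_def by (rule norm_add_Pythagorean) (use orth in \<open>simp add: orthogonal_clauses\<close>)
    then show ?thesis using x y by (simp add: power2_eq_1_iff) (smt (verit) norm_ge_zero)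
  qed
  have trig: "trig_poly d (\<lambda>t. h t $ i)" for i
    unfolding h_def g_def system_map_def
    using trig_poly_mono[OF trig_poly_mpoly_eval[OF hom] le] by simp
  have "norm ((real d * cos \<alpha>) *\<^sub>R h 0 + sin \<alpha> *\<^sub>R system_deriv P x y) \<le> real d * sup_norm P"
    using norm_system_map_le_sup_norm[OF norm_g] by (intro bernstein_szego d trig h') (simp add: h_def)
  then show ?thesis by (simp add: h_def g0)
qed

lemma norm_system_deriv_orthogonal_le:
  fixes P :: "'n::finite real_mpoly ^ 'm::finite"
  assumes hom: "\<And>i. homogeneous (\<delta> i) (P $ i)" and le: "\<And>i. \<delta> i \<le> d"
    and xy: "norm x = 1" "norm y = 1" "orthogonal x y"
  shows "norm (system_deriv P x y) \<le> real d * sup_norm P"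
proof (cases "d = 0")
  case True
  then have "system_deriv P x y = 0"
    using hom le by (simp add: vec_eq_iff) (metis system_deriv_degree_0)
  then show ?thesis using True by simp
next
  case False
  then show ?thesis using norm_great_circle_le[OF hom le _ xy, where \<alpha> = "pi / 2"] by simp
qed

lemma norm_system_deriv_radial_le:
  fixes P :: "'n::finite real_mpoly ^ 'm::finite"
  assumes hom: "\<And>i. homogeneous (\<delta> i) (P $ i)" and le: "\<And>i. \<delta> i \<le> d" and x: "norm x = 1"
  shows "norm (system_deriv P x x) \<le> real d * sup_norm P"
proof -
  have "norm (system_deriv P x x) \<le> norm (real d *\<^sub>R system_map P x)"
    by (rule norm_le_componentwise_cart)
       (use le in \<open>simp add: system_deriv_radial[OF hom] abs_mult mult_right_mono\<close>)
  also have "\<dots> \<le> real d * sup_norm P"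
    using norm_system_map_le_sup_norm[OF x, of P] by (simp add: mult_left_mono)
  finally show ?thesis .
qed

text \<open>In dimension one no unit vector is orthogonal to \<open>x\<close>, so the second alternative cannot be
  absorbed into the first.\<close>

lemma unit_vector_decomposition:
  fixes x u :: "real ^ 'n"
  assumes x: "norm x = 1" and u: "norm u = 1"
  obtains \<alpha> y where "norm y = 1" "orthogonal x y" "u = cos \<alpha> *\<^sub>R x + sin \<alpha> *\<^sub>R y"
    | a where "\<bar>a\<bar> = 1" "u = a *\<^sub>R x"
proof -
  define a where "a = x \<bullet> u"
  define w where "w = u - a *\<^sub>R x"
  have xx: "x \<bullet> x = 1" using x by (simp add: dot_square_norm)
  have orth: "x \<bullet> w = 0" by (simp add: w_def a_def inner_diff_right xx)
  have u_eq: "u = a *\<^sub>R x + w" by (simp add: w_def)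
  have "(norm u)\<^sup>2 = (norm (a *\<^sub>R x))\<^sup>2 + (norm w)\<^sup>2"
    unfolding u_eq by (rule norm_add_Pythagorean) (simp add: orthogonal_def orth)
  then have pyth: "a\<^sup>2 + (norm w)\<^sup>2 = 1" using x u by simp
  show thesis
  proof (cases "w = 0")
    case True
    then have "\<bar>a\<bar> = 1" using pyth by (auto simp: power2_eq_1_iff)
    then show thesis using that(2)[of a] u_eq True by simp
  next
    case False
    obtain \<alpha> where \<alpha>: "a = cos \<alpha>" "norm w = sin \<alpha>" using sincos_total_2pi[OF pyth] by metis
    have "w = sin \<alpha> *\<^sub>R (w /\<^sub>R norm w)" using False by (simp flip: \<alpha>(2))
    then show thesis
      using that(1)[of "w /\<^sub>R norm w" \<alpha>] False orth u_eq \<alpha>(1) by (simp add: orthogonal_def)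
  qed
qed

text \<open>Since \<open>DP(x)(x) = d P x\<close>, the Bernstein--Szego inequality bounds the tangential and the radial
  part of the derivative jointly, without the factor that the triangle inequality would cost.\<close>

lemma norm_system_deriv_le_pure_degree:
  fixes P :: "'n::finite real_mpoly ^ 'm::finite"
  assumes hom: "\<And>i. homogeneous d (P $ i)" and x: "norm x = 1" and u: "norm u = 1"
  shows "norm (system_deriv P x u) \<le> real d * sup_norm P"
  using x u
proof (cases rule: unit_vector_decomposition)
  case (1 \<alpha> y)
  have radial: "system_deriv P x x = real d *\<^sub>R system_map P x"
    by (simp add: vec_eq_iff system_deriv_radial[OF hom])
  have "system_deriv P x u = cos \<alpha> *\<^sub>R system_deriv P x x + sin \<alpha> *\<^sub>R system_deriv P x y"
    unfolding 1(3) by (simp add: linear_add[OF system_deriv_linear] linear_scale[OF system_deriv_linear])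
  then have eq: "system_deriv P x u = (real d * cos \<alpha>) *\<^sub>R system_map P x + sin \<alpha> *\<^sub>R system_deriv P x y"
    by (simp add: radial mult.commute)
  show ?thesis
  proof (cases "d = 0")
    case True
    then have "system_deriv P x u = 0"
      using hom by (simp add: vec_eq_iff system_deriv_degree_0)
    then show ?thesis using True by simp
  next
    case False
    then show ?thesis unfolding eq by (intro norm_great_circle_le[OF hom] x 1) auto
  qed
next
  case (2 a)
  then have "norm (system_deriv P x u) = norm (system_deriv P x x)"
    using system_deriv_linear[of P x] by (simp add: linear_scale)
  then show ?thesis using norm_system_deriv_radial_le[OF hom _ x] by simp
qed

text \<open>For \<open>d \<ge> 2\<close> the square leaves room for the crude estimate \<open>\<bar>cos \<alpha>\<bar> + \<bar>sin \<alpha>\<bar> \<le> 2 \<le> d\<close>. For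
  \<open>d \<le> 1\<close> it leaves none, but there the degrees below \<open>d\<close> contribute nothing to the derivative
  and can only enlarge the norm of the system.\<close>

lemma norm_system_deriv_le_mixed_degree:
  fixes P :: "'n::finite real_mpoly ^ 'm::finite"
  assumes hom: "\<And>i. homogeneous (\<delta> i) (P $ i)" and le: "\<And>i. \<delta> i \<le> d"
    and x: "norm x = 1" and u: "norm u = 1"
  shows "norm (system_deriv P x u) \<le> (real d)\<^sup>2 * sup_norm P"
proof (cases "d \<ge> 2")
  case True
  define B where "B = real d * sup_norm P"
  have "B \<ge> 0" by (simp add: B_def sup_norm_nonneg)
  have radial: "norm (system_deriv P x x) \<le> B"
    unfolding B_def by (rule norm_system_deriv_radial_le[OF hom le x])
  have "norm (system_deriv P x u) \<le> 2 * B"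
    using x u
  proof (cases rule: unit_vector_decomposition)
    case (1 \<alpha> y)
    have "norm (system_deriv P x u) =
        norm (cos \<alpha> *\<^sub>R system_deriv P x x + sin \<alpha> *\<^sub>R system_deriv P x y)"
      unfolding 1(3) by (simp add: linear_add[OF system_deriv_linear] linear_scale[OF system_deriv_linear])
    also have "\<dots> \<le> \<bar>cos \<alpha>\<bar> * norm (system_deriv P x x) + \<bar>sin \<alpha>\<bar> * norm (system_deriv P x y)"
      using norm_triangle_ineq[of "cos \<alpha> *\<^sub>R system_deriv P x x" "sin \<alpha> *\<^sub>R system_deriv P x y"]
      by simp
    also have "\<dots> \<le> 1 * B + 1 * B"
      unfolding B_def
      by (intro add_mono mult_mono radial[unfolded B_def] norm_system_deriv_orthogonal_le[OF hom le]) (use x 1 in auto)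
    finally show ?thesis by simp
  next
    case (2 a)
    then have "norm (system_deriv P x u) = norm (system_deriv P x x)"
      using system_deriv_linear[of P x] by (simp add: linear_scale)
    then show ?thesis using radial \<open>B \<ge> 0\<close> by simp
  qed
  also have "\<dots> \<le> real d * B"
    using True \<open>B \<ge> 0\<close> by (intro mult_right_mono) auto
  finally show ?thesis by (simp add: B_def power2_eq_square)
next
  case False
  define Q :: "'n real_mpoly ^ 'm" where "Q = (\<chi> i. if \<delta> i = d then P $ i else 0)"
  have "homogeneous d (Q $ i)" for i
    using hom[of i] by (auto simp: Q_def homogeneous_def)
  then have "norm (system_deriv Q x u) \<le> real d * sup_norm Q"
    by (rule norm_system_deriv_le_pure_degree[OF _ x u])
  moreover have "system_deriv P x u = system_deriv Q x u"
  proof -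
    have "system_deriv P x u $ i = system_deriv Q x u $ i" for i
    proof (cases "\<delta> i = d")
      case True
      then show ?thesis by (simp add: Q_def system_deriv_nth)
    next
      \<comment> \<open>Below the maximal degree \<open>d \<le> 1\<close> there is only degree \<open>0\<close>.\<close>
      case neq: False
      then have "\<delta> i = 0" using le[of i] False by linarith
      then have "system_deriv P x u $ i = 0" using hom[of i] by (simp add: system_deriv_degree_0)
      then show ?thesis using neq by (simp add: Q_def system_deriv_nth)
    qed
    then show ?thesis by (simp add: vec_eq_iff)
  qed
  moreover have "sup_norm Q \<le> sup_norm P"
    by (intro sup_norm_mono norm_le_componentwise_cart) (simp add: Q_def system_map_def mpoly_eval_def)
  moreover have "(real d)\<^sup>2 = real d"
    using False by (cases "d = 0") (auto simp: not_le less_2_cases_iff)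
  ultimately show ?thesis by (smt (verit) mult_left_mono of_nat_0_le_iff)
qed

theorem theorem2p4:
  fixes P :: "'n::finite real_mpoly ^ 'm::finite"
    and \<delta> :: "'m \<Rightarrow> nat"
    and d :: nat
  assumes "\<And>i. homogeneous (\<delta> i) (P $ i)"
    and "d = Max (range \<delta>)"
  shows "(deriv_sup_norm P \<le> real d ^ 2 * sup_norm P \<and>
          (\<forall>x\<in>sphere 0 1. \<forall>y\<in>sphere 0 1. orthogonal x y \<longrightarrow>
             norm (system_deriv P x y) \<le> real d * sup_norm P)) \<and>
         ((\<forall>i. \<delta> i = d) \<longrightarrow> deriv_sup_norm P \<le> real d * sup_norm P)"
proof (intro conjI ballI impI)
  have le: "\<delta> i \<le> d" for i using assms(2) by simp
  show "deriv_sup_norm P \<le> (real d)\<^sup>2 * sup_norm P"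
    by (intro deriv_sup_norm_least norm_system_deriv_le_mixed_degree[OF assms(1) le])
  show "norm (system_deriv P x y) \<le> real d * sup_norm P"
    if "x \<in> sphere 0 1" "y \<in> sphere 0 1" "orthogonal x y" for x y
    using that by (intro norm_system_deriv_orthogonal_le[OF assms(1) le]) auto
  show "deriv_sup_norm P \<le> real d * sup_norm P" if "\<forall>i. \<delta> i = d"
    using assms(1) that by (intro deriv_sup_norm_least norm_system_deriv_le_pure_degree) metis
qed

end
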